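(* Let $n\ge 2$, $\lambda\in\mathbb{R}$, let $\mu$ be a positive Borel measure on $S^{n-1}$, and let $u(x)=\int_{S^{n-1}}P_\lambda(x,\xi)\,d\mu(\xi)$, $x\in B^n$, be the positive invariant harmonic function in $B^n$ defined by $\mu$ with the Poisson kernel $P_\lambda$. Let $\zeta\in S^{n-1}$ and $0\le r'\le r<1$. If $\lambda>-\frac n2$, then $$\left(\frac{1-r}{1-r'}\right)^{2\lambda+1}\left(\frac{1+r'}{1+r}\right)^{n-1}u(r'\zeta)\le u(r\zeta)\le\left(\frac{1+r}{1+r'}\right)^{2\lambda+1}\left(\frac{1-r'}{1-r}\right)^{n-1}u(r'\zeta).$$ If $\lambda<-\frac n2$, then $$\left(\frac{1+r}{1+r'}\right)^{2\lambda+1}\left(\frac{1-r'}{1-r}\right)^{n-1}u(r'\zeta)\le u(r\zeta)\le\left(\frac{1-r}{1-r'}\right)^{2\lambda+1}\left(\frac{1+r'}{1+r}\right)^{n-1}u(r'\zeta).$$ In particular, for $r'=0$, $$\frac{(1-r)^{1+2\lambda}}{(1+r)^{n-1}}u(0)\le u(r\zeta)\le\frac{(1+r)^{1+2\lambda}}{(1-r)^{n-1}}u(0)\quad\text{if }\lambda>-\tfrac n2,$$ and $$\frac{(1+r)^{1+2\lambda}}{(1-r)^{n-1}}u(0)\le u(r\zeta)\le\frac{(1-r)^{1+2\lambda}}{(1+r)^{n-1}}u(0)\quad\text{if }\lambda<-\tfrac n2.$$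
   Context: $B^n=\{x\in\mathbb{R}^n:|x|<1\}$, $S^{n-1}=\partial B^n$. The Poisson kernel is $P_\lambda(x,\zeta)=\dfrac{(1-|x|^2)^{1+2\lambda}}{|x-\zeta|^{n+2\lambda}}$ for $x\in B^n$, $\zeta\in S^{n-1}$. Invariant harmonic functions are the solutions of $\Delta_\lambda u=0$, where $\Delta_\lambda=(1-|x|^2)\left\{\frac{1-|x|^2}{4}\sum_j\frac{\partial^2}{\partial x_j^2}+\lambda\sum_j x_j\frac{\partial}{\partial x_j}+\lambda\left(\frac n2-1-\lambda\right)\right\}$; integrals of $P_\lambda$ against $\mu$ are known to be invariant harmonic. That $u$ is a positive function means $0<u(x)<\infty$ for all $x\in B^n$ (so $\mu$ is finite and nonzero). *)

theory Defs
  imports "HOL-Analysis.Analysis"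
begin

text \<open>The exponents are arbitrary reals, hence \<open>powr\<close>; both bases are positive for
  \<open>x\<close> in the open unit ball and \<open>z\<close> on the unit sphere.\<close>

definition poisson_kernel :: "real \<Rightarrow> real ^ 'n \<Rightarrow> real ^ 'n \<Rightarrow> real" where
  "poisson_kernel lam x z =
     (1 - (norm x)\<^sup>2) powr (1 + 2 * lam) / norm (x - z) powr (real CARD('n) + 2 * lam)"

end

theory Submission
  imports Defs
begin

text \<open>
  Fix a unit vector \<open>\<zeta>\<close> and look at \<open>u\<close> along the whole diameter \<open>t *\<^sub>R \<zeta>\<close>, \<open>-1 < t < 1\<close>. With
  \<open>w t = (1 - t) powr (1 + 2\<lambda>) / (1 + t) ^ (n - 1)\<close> the kernel factors as
  \<open>P (t *\<^sub>R \<zeta>) \<xi> = w t * ((1 + t) / norm (t *\<^sub>R \<zeta> - \<xi>)) powr (n + 2\<lambda>)\<close>,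
  and the ratio in the second factor is nondecreasing in \<open>t\<close>, because its square has reciprocal
  \<open>1 - 2 (1 + \<zeta> \<bullet> \<xi>) t / (1 + t)\<^sup>2\<close> and \<open>t / (1 + t)\<^sup>2\<close> increases on \<open>(-1, 1)\<close>. So \<open>P / w\<close>, and after integration \<open>u / w\<close>, is
  monotone along the diameter: increasing or decreasing according to the sign of \<open>n + 2\<lambda>\<close>.

  For \<open>r' \<le> r\<close> this is one of the two inequalities in each case. The other one is the same
  monotonicity for the antipodal vector \<open>-\<zeta>\<close> and the parameters \<open>-r \<le> -r'\<close>: reversing the
  diameter swaps \<open>1 - r\<close> with \<open>1 + r\<close> and the order of the two points. This is why the lemmas
  allow negative radii.
\<close>

definition radial_weight :: "real \<Rightarrow> nat \<Rightarrow> real \<Rightarrow> real" where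
  "radial_weight lam n t = (1 - t) powr (1 + 2 * lam) / (1 + t) ^ (n - 1)"

lemma radial_weight_pos: "-1 < t \<Longrightarrow> t < 1 \<Longrightarrow> 0 < radial_weight lam n t"
  by (simp add: radial_weight_def)

lemma radial_weight_divide:
  assumes "-1 < s" "s < 1" "-1 < r" "r < 1"
  shows "radial_weight lam n r / radial_weight lam n s
         = ((1 - r) / (1 - s)) powr (2 * lam + 1) * ((1 + s) / (1 + r)) ^ (n - 1)"
  using assms by (simp add: radial_weight_def powr_divide power_divide add.commute)

lemma poisson_kernel_on_diameter:
  fixes \<zeta> \<xi> :: "real ^ 'n"
  assumes "norm \<zeta> = 1" "norm \<xi> = 1" "-1 < t" "t < 1"
  shows "poisson_kernel lam (t *\<^sub>R \<zeta>) \<xi>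
         = radial_weight lam CARD('n) t
           * ((1 + t) / norm (t *\<^sub>R \<zeta> - \<xi>)) powr (real CARD('n) + 2 * lam)"
proof -
  have "(1 + t) powr (real CARD('n) + 2 * lam)
        = (1 + t) powr (real (CARD('n) - 1) + (1 + 2 * lam))"
    by (simp add: of_nat_diff Suc_leI)
  also have "\<dots> = (1 + t) ^ (CARD('n) - 1) * (1 + t) powr (1 + 2 * lam)"
    unfolding powr_add by (subst powr_realpow) (use assms in auto)
  finally have split_exponent: "(1 + t) powr (real CARD('n) + 2 * lam)
      = (1 + t) ^ (CARD('n) - 1) * (1 + t) powr (1 + 2 * lam)" .
  have "1 - (norm (t *\<^sub>R \<zeta>))\<^sup>2 = (1 - t) * (1 + t)"
    using assms by (simp add: power2_eq_square algebra_simps)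
  then show ?thesis
    using assms
    by (simp add: poisson_kernel_def radial_weight_def powr_divide powr_mult split_exponent)
qed

text \<open>
  After squaring, the difference of the two sides is
  \<open>2 (1 + \<zeta> \<bullet> \<xi>) (r - s) (1 - r s)\<close>, a product of nonnegative factors. The triangle inequality
  only bounds the ratio of the distances by \<open>1 + (r - s) / norm (s *\<^sub>R \<zeta> - \<xi>)\<close>, which for
  \<open>0 < s < r\<close> and \<open>\<xi>\<close> near \<open>\<zeta>\<close> is larger than \<open>(1 + r) / (1 + s)\<close>.
\<close>

lemma norm_diameter_minus_sphere_le:
  fixes \<zeta> \<xi> :: "'a::real_inner"
  assumes unit: "norm \<zeta> = 1" "norm \<xi> = 1" and st: "-1 < s" "s \<le> r" "r < 1"
  shows "(1 + s) * norm (r *\<^sub>R \<zeta> - \<xi>) \<le> (1 + r) * norm (s *\<^sub>R \<zeta> - \<xi>)"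
proof (rule power2_le_imp_le)
  have dist_sq: "(norm (t *\<^sub>R \<zeta> - \<xi>))\<^sup>2 = (1 + t)\<^sup>2 - 2 * t * (1 + \<zeta> \<bullet> \<xi>)" for t
    using unit unfolding power2_norm_eq_inner norm_eq_1
    by (simp add: inner_diff_left inner_diff_right inner_commute power2_eq_square algebra_simps)
  have "-1 \<le> \<zeta> \<bullet> \<xi>"
    using Cauchy_Schwarz_ineq2[of \<zeta> \<xi>] unit by simp
  moreover have "r * s \<le> 1"
  proof -
    have "\<bar>r\<bar> * \<bar>s\<bar> \<le> 1 * 1" using st by (intro mult_mono) auto
    then show ?thesis by (simp add: abs_mult[symmetric])
  qed
  ultimately have "0 \<le> 2 * (1 + \<zeta> \<bullet> \<xi>) * ((r - s) * (1 - r * s))"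
    using st by (intro mult_nonneg_nonneg) auto
  also have "\<dots> = ((1 + r) * norm (s *\<^sub>R \<zeta> - \<xi>))\<^sup>2 - ((1 + s) * norm (r *\<^sub>R \<zeta> - \<xi>))\<^sup>2"
    unfolding power_mult_distrib dist_sq by (simp add: power2_eq_square algebra_simps)
  finally show "((1 + s) * norm (r *\<^sub>R \<zeta> - \<xi>))\<^sup>2 \<le> ((1 + r) * norm (s *\<^sub>R \<zeta> - \<xi>))\<^sup>2"
    by simp
  show "0 \<le> (1 + r) * norm (s *\<^sub>R \<zeta> - \<xi>)" using st by simp
qed

lemma poisson_kernel_over_weight_monotone:
  fixes \<zeta> \<xi> :: "real ^ 'n" and lam :: real
  assumes unit: "norm \<zeta> = 1" "norm \<xi> = 1" and st: "-1 < s" "s \<le> r" "r < 1"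
  defines "P \<equiv> \<lambda>t. poisson_kernel lam (t *\<^sub>R \<zeta>) \<xi> / radial_weight lam CARD('n) t"
  shows "lam \<ge> - real CARD('n) / 2 \<Longrightarrow> P s \<le> P r"
    and "lam \<le> - real CARD('n) / 2 \<Longrightarrow> P r \<le> P s"
proof -
  define q where "q = (\<lambda>t. (1 + t) / norm (t *\<^sub>R \<zeta> - \<xi>))"
  have dist_pos: "0 < norm (t *\<^sub>R \<zeta> - \<xi>)" if "-1 < t" "t < 1" for t
  proof -
    have "norm (t *\<^sub>R \<zeta>) \<noteq> norm \<xi>" using unit that by simp
    then show ?thesis by auto
  qed
  have P_eq: "P t = q t powr (real CARD('n) + 2 * lam)" if "-1 < t" "t < 1" for t
    using poisson_kernel_on_diameter[OF unit that, of lam]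
      radial_weight_pos[OF that, of lam "CARD('n)"]
    by (simp add: P_def q_def)
  have q_pos: "0 < q s" using dist_pos[of s] st by (simp add: q_def)
  have q_mono: "q s \<le> q r"
    using norm_diameter_minus_sphere_le[OF unit st] dist_pos[of s] dist_pos[of r] st
    by (simp add: q_def field_simps)
  show "P s \<le> P r" if "lam \<ge> - real CARD('n) / 2"
    using that st q_pos q_mono by (simp add: P_eq powr_mono2)
  show "P r \<le> P s" if "lam \<le> - real CARD('n) / 2"
    using that st q_pos q_mono by (simp add: P_eq powr_mono2')
qed

lemma poisson_integral_over_weight_monotone:
  fixes \<mu> :: "(real ^ 'n) measure" and \<zeta> :: "real ^ 'n" and lam :: real
  assumes space: "space \<mu> = sphere 0 1"
    and integrable: "\<And>x. x \<in> ball 0 1 \<Longrightarrow> integrable \<mu> (poisson_kernel lam x)"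
    and unit: "norm \<zeta> = 1" and st: "-1 < s" "s \<le> r" "r < 1"
  defines "U \<equiv> \<lambda>t. (\<integral>\<xi>. poisson_kernel lam (t *\<^sub>R \<zeta>) \<xi> \<partial>\<mu>) / radial_weight lam CARD('n) t"
  shows "lam \<ge> - real CARD('n) / 2 \<Longrightarrow> U s \<le> U r"
    and "lam \<le> - real CARD('n) / 2 \<Longrightarrow> U r \<le> U s"
proof -
  let ?P = "\<lambda>t \<xi>. poisson_kernel lam (t *\<^sub>R \<zeta>) \<xi> / radial_weight lam CARD('n) t"
  have U_eq: "U t = (\<integral>\<xi>. ?P t \<xi> \<partial>\<mu>)" for t by (simp add: U_def)
  have int: "integrable \<mu> (?P t)" if "-1 < t" "t < 1" for t
  proof -
    have "t *\<^sub>R \<zeta> \<in> ball 0 1" using that unit by simp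
    from integrable[OF this] show ?thesis by simp
  qed
  have on_sphere: "norm \<xi> = 1" if "\<xi> \<in> space \<mu>" for \<xi> using that space by simp
  show "U s \<le> U r" if "lam \<ge> - real CARD('n) / 2"
    unfolding U_eq using st
    by (intro integral_mono int poisson_kernel_over_weight_monotone(1)[OF unit on_sphere _ _ _ that])
      auto
  show "U r \<le> U s" if "lam \<le> - real CARD('n) / 2"
    unfolding U_eq using st
    by (intro integral_mono int poisson_kernel_over_weight_monotone(2)[OF unit on_sphere _ _ _ that])
      auto
qed

theorem theorem1p2:
  fixes lam :: real
    and \<mu> :: "(real ^ 'n) measure"
    and u :: "real ^ 'n \<Rightarrow> real"
    and \<zeta> :: "real ^ 'n"
    and r r' :: real
  assumes n_ge_2: "CARD('n) \<ge> 2"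
    and borel_on_sphere: "sets \<mu> = sets (restrict_space borel (sphere 0 1))"
    and finite_u: "\<And>x. x \<in> ball 0 1 \<Longrightarrow> integrable \<mu> (\<lambda>\<xi>. poisson_kernel lam x \<xi>)"
    and u_eq: "\<And>x. x \<in> ball 0 1 \<Longrightarrow> u x = (\<integral>\<xi>. poisson_kernel lam x \<xi> \<partial>\<mu>)"
    and positive_u: "\<And>x. x \<in> ball 0 1 \<Longrightarrow> 0 < u x"
    and zeta: "\<zeta> \<in> sphere 0 1"
    and radii: "0 \<le> r'" "r' \<le> r" "r < 1"
  shows "(lam > - real CARD('n) / 2 \<longrightarrow>
            ((1 - r) / (1 - r')) powr (2 * lam + 1) * ((1 + r') / (1 + r)) ^ (CARD('n) - 1)
              * u (r' *\<^sub>R \<zeta>) \<le> u (r *\<^sub>R \<zeta>) \<and>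
            u (r *\<^sub>R \<zeta>) \<le>
              ((1 + r) / (1 + r')) powr (2 * lam + 1) * ((1 - r') / (1 - r)) ^ (CARD('n) - 1)
              * u (r' *\<^sub>R \<zeta>)) \<and>
         (lam < - real CARD('n) / 2 \<longrightarrow>
            ((1 + r) / (1 + r')) powr (2 * lam + 1) * ((1 - r') / (1 - r)) ^ (CARD('n) - 1)
              * u (r' *\<^sub>R \<zeta>) \<le> u (r *\<^sub>R \<zeta>) \<and>
            u (r *\<^sub>R \<zeta>) \<le>
              ((1 - r) / (1 - r')) powr (2 * lam + 1) * ((1 + r') / (1 + r)) ^ (CARD('n) - 1)
              * u (r' *\<^sub>R \<zeta>)) \<and>
         (lam > - real CARD('n) / 2 \<longrightarrow>
            (1 - r) powr (1 + 2 * lam) / (1 + r) ^ (CARD('n) - 1) * u 0 \<le> u (r *\<^sub>R \<zeta>) \<and>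
            u (r *\<^sub>R \<zeta>) \<le> (1 + r) powr (1 + 2 * lam) / (1 - r) ^ (CARD('n) - 1) * u 0) \<and>
         (lam < - real CARD('n) / 2 \<longrightarrow>
            (1 + r) powr (1 + 2 * lam) / (1 - r) ^ (CARD('n) - 1) * u 0 \<le> u (r *\<^sub>R \<zeta>) \<and>
            u (r *\<^sub>R \<zeta>) \<le> (1 - r) powr (1 + 2 * lam) / (1 + r) ^ (CARD('n) - 1) * u 0)"
proof -
  define w where "w = radial_weight lam CARD('n)"
  have space: "space \<mu> = sphere 0 1"
    using sets_eq_imp_space_eq[OF borel_on_sphere] by (simp add: space_restrict_space)
  have monotone: "(lam > - real CARD('n) / 2 \<longrightarrow> u (a *\<^sub>R z) / w a \<le> u (b *\<^sub>R z) / w b) \<and>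
                  (lam < - real CARD('n) / 2 \<longrightarrow> u (b *\<^sub>R z) / w b \<le> u (a *\<^sub>R z) / w a)"
    if z: "norm z = 1" and ab: "-1 < a" "a \<le> b" "b < 1" for z a b
  proof -
    have "a *\<^sub>R z \<in> ball 0 1" "b *\<^sub>R z \<in> ball 0 1" using z ab by auto
    note u = this[THEN u_eq]
    show ?thesis
      using poisson_integral_over_weight_monotone[OF space finite_u z ab] by (simp add: u w_def)
  qed
  have w_pos: "0 < w t" if "-1 < t" "t < 1" for t
    using radial_weight_pos[OF that] by (simp add: w_def)
  have bounds:
    "(lam > - real CARD('n) / 2 \<longrightarrow>
        w b / w a * u (a *\<^sub>R \<zeta>) \<le> u (b *\<^sub>R \<zeta>) \<and>
        u (b *\<^sub>R \<zeta>) \<le> w (- b) / w (- a) * u (a *\<^sub>R \<zeta>)) \<and>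
     (lam < - real CARD('n) / 2 \<longrightarrow>
        w (- b) / w (- a) * u (a *\<^sub>R \<zeta>) \<le> u (b *\<^sub>R \<zeta>) \<and>
        u (b *\<^sub>R \<zeta>) \<le> w b / w a * u (a *\<^sub>R \<zeta>))"
    if ab: "0 \<le> a" "a \<le> b" "b < 1" for a b
    using monotone[of \<zeta> a b] monotone[of "- \<zeta>" "- b" "- a"] zeta ab
      w_pos[of a] w_pos[of b] w_pos[of "- a"] w_pos[of "- b"]
    by (simp add: field_simps)
  have quotients:
    "w b / w a = ((1 - b) / (1 - a)) powr (2 * lam + 1) * ((1 + a) / (1 + b)) ^ (CARD('n) - 1)"
    "w (- b) / w (- a)
       = ((1 + b) / (1 + a)) powr (2 * lam + 1) * ((1 - a) / (1 - b)) ^ (CARD('n) - 1)"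
    if "0 \<le> a" "a \<le> b" "b < 1" for a b
    using radial_weight_divide[of a b lam "CARD('n)"]
      radial_weight_divide[of "- a" "- b" lam "CARD('n)"] that
    by (simp_all add: w_def)
  have from_centre:
    "w r / w 0 = (1 - r) powr (1 + 2 * lam) / (1 + r) ^ (CARD('n) - 1)"
    "w (- r) / w (- 0) = (1 + r) powr (1 + 2 * lam) / (1 - r) ^ (CARD('n) - 1)"
    by (simp_all add: w_def radial_weight_def)
  have "0 \<le> r" using radii by simp
  note centre = bounds[OF order_refl this radii(3), unfolded from_centre scaleR_zero_left]
  show ?thesis
    using bounds[OF radii, unfolded quotients[OF radii]] centre by blast
qed

end
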